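(* Let $q$ be a prime power and $n\ge1$. The extension of any semifield spread of $W(2n-1,q)$ to a partial spread of $H(2n-1,q^2)$ is maximal, i.e. it is not strictly contained in a larger partial spread of $H(2n-1,q^2)$.
   Context: For $x\in\mathbb{F}_{q^2}$ let $\overline{x}=x^q$, applied entrywise to matrices. $H(2n-1,q^2)$ is the hermitian polar space: the totally isotropic subspaces of $\mathrm{PG}(2n-1,q^2)$ with respect to the non-degenerate hermitian form with matrix $\begin{pmatrix}0_n& aI_n\\ -aI_n&0_n\end{pmatrix}$, where $a\in\mathbb{F}_{q^2}^\times$ with $\overline{a}=-a$. $W(2n-1,q)$ is the symplectic polar space: the totally isotropic subspaces of $\mathrm{PG}(2n-1,q)\subseteq\mathrm{PG}(2n-1,q^2)$ with respect to the symplectic form with matrix $\begin{pmatrix}0_n& I_n\\ -I_n&0_n\end{pmatrix}$. A partial spread of a polar space is a set of pairwise disjoint $(n-1)$-dimensional (projective) subspaces of it; a spread is a partial spread covering all points. For an $n\times n$ matrix $A$ let $S_A=\langle (u,Au)^T : u\ne 0\rangle$ and $S_\infty=\langle (0,u)^T: u\neq 0\rangle$. A semifield spread of $W(2n-1,q)$ is a spread that is equivalent (under an isometry of the polar space) to $D_U=\{S_A:A\in U\}\cup\{S_\infty\}$ where $U$ is a set of $q^n$ symmetric $n\times n$ matrices over $\mathbb{F}_q$, closed under addition (and under scalar multiplication by some subfield of $\mathbb{F}_q$), with every nonzero element invertible (a linear spread set). The extension of a partial spread $D$ of $W(2n-1,q)$ is the set of subspaces of $\mathrm{PG}(2n-1,q^2)$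 obtained by extending scalars of each element of $D$ from $\mathbb{F}_q$ to $\mathbb{F}_{q^2}$; it is a partial spread of $H(2n-1,q^2)$. *)

theory Defs
  imports "HOL-Analysis.Analysis" "HOL-Number_Theory.Prime_Powers"
begin

(* A subspace of PG(2n-1,F) is represented by the underlying linear subspace of F^(2n), where
   n = CARD('n) and the 2n coordinates are indexed by 'n + 'n. Hence projective dimension n-1
   is linear dimension n, points are linear subspaces of dimension 1, and projectively disjoint
   means that the linear subspaces meet in {0}. *)

definition block_vec :: "'f^'n \<Rightarrow> 'f^'n \<Rightarrow> 'f^('n::finite + 'n)" where
  "block_vec u v = (\<chi> i. case i of Inl k \<Rightarrow> u $ k | Inr k \<Rightarrow> v $ k)"

definition block_mat ::
  "'f^'n^'n \<Rightarrow> 'f^'n^'n \<Rightarrow> 'f^'n^'n \<Rightarrow> 'f^'n^'n \<Rightarrow> 'f^('n::finite + 'n)^('n + 'n)" where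
  "block_mat A B C D = (\<chi> i j. case i of
      Inl k \<Rightarrow> (case j of Inl l \<Rightarrow> A $ k $ l | Inr l \<Rightarrow> B $ k $ l)
    | Inr k \<Rightarrow> (case j of Inl l \<Rightarrow> C $ k $ l | Inr l \<Rightarrow> D $ k $ l))"

definition symplectic_form :: "'f::field^('n::finite + 'n) \<Rightarrow> 'f^('n + 'n) \<Rightarrow> 'f" where
  "symplectic_form x y =
     (\<Sum>i\<in>UNIV. \<Sum>j\<in>UNIV. x $ i * block_mat 0 (mat 1) (- mat 1) 0 $ i $ j * y $ j)"

(* Conjugation is the map c \<mapsto> c ^ q; the form is used for fields of order q^2 and
   scalars a \<noteq> 0 with a ^ q = - a, when it is hermitian and non-degenerate. *)
definition hermitian_form ::
  "nat \<Rightarrow> 'f::field \<Rightarrow> 'f^('n::finite + 'n) \<Rightarrow> 'f^('n + 'n) \<Rightarrow> 'f" where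
  "hermitian_form q a x y =
     (\<Sum>i\<in>UNIV. \<Sum>j\<in>UNIV. x $ i * block_mat 0 (mat a) (- mat a) 0 $ i $ j * (y $ j) ^ q)"

definition totally_isotropic ::
  "('f::field^'m::finite \<Rightarrow> 'f^'m \<Rightarrow> 'f) \<Rightarrow> ('f^'m) set \<Rightarrow> bool" where
  "totally_isotropic f S \<longleftrightarrow> (\<forall>x\<in>S. \<forall>y\<in>S. f x y = 0)"

definition symplectic_polar_space :: "('f::field^('n::finite + 'n)) set set" where
  "symplectic_polar_space = {S. vec.subspace S \<and> totally_isotropic symplectic_form S}"

definition hermitian_polar_space ::
  "nat \<Rightarrow> 'f::field \<Rightarrow> ('f^('n::finite + 'n)) set set" where
  "hermitian_polar_space q a = {S. vec.subspace S \<and> totally_isotropic (hermitian_form q a) S}"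

definition partial_spread ::
  "('f::field^('n::finite + 'n)) set set \<Rightarrow> ('f^('n + 'n)) set set \<Rightarrow> bool" where
  "partial_spread P D \<longleftrightarrow>
     D \<subseteq> {S \<in> P. vec.dim S = CARD('n)} \<and> (\<forall>S\<in>D. \<forall>T\<in>D. S \<noteq> T \<longrightarrow> S \<inter> T = {0})"

definition spread ::
  "('f::field^('n::finite + 'n)) set set \<Rightarrow> ('f^('n + 'n)) set set \<Rightarrow> bool" where
  "spread P D \<longleftrightarrow>
     partial_spread P D \<and> (\<forall>p\<in>P. vec.dim p = 1 \<longrightarrow> (\<exists>S\<in>D. p \<subseteq> S))"

definition maximal_partial_spread ::
  "('f::field^('n::finite + 'n)) set set \<Rightarrow> ('f^('n + 'n)) set set \<Rightarrow> bool" where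
  "maximal_partial_spread P D \<longleftrightarrow>
     partial_spread P D \<and> \<not> (\<exists>E. partial_spread P E \<and> D \<subset> E)"

definition graph_space :: "'f::field^'n::finite^'n \<Rightarrow> ('f^('n + 'n)) set" where
  "graph_space A = vec.span {block_vec u (A *v u) |u. u \<noteq> 0}"

definition infinity_space :: "('f::field^('n::finite + 'n)) set" where
  "infinity_space = vec.span {block_vec 0 u |u. u \<noteq> 0}"

definition subfield_of :: "'f::field set \<Rightarrow> bool" where
  "subfield_of K \<longleftrightarrow> 0 \<in> K \<and> 1 \<in> K \<and>
     (\<forall>x\<in>K. \<forall>y\<in>K. x + y \<in> K \<and> x * y \<in> K) \<and> (\<forall>x\<in>K. - x \<in> K \<and> inverse x \<in> K)"

definition linear_spread_set :: "('f::{field,finite}^'n::finite^'n) set \<Rightarrow> bool" where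
  "linear_spread_set U \<longleftrightarrow>
     card U = CARD('f) ^ CARD('n) \<and>
     (\<forall>A\<in>U. transpose A = A) \<and>
     (\<forall>A\<in>U. \<forall>B\<in>U. A + B \<in> U) \<and>
     (\<exists>K. subfield_of K \<and> (\<forall>c\<in>K. \<forall>A\<in>U. map_matrix ((*) c) A \<in> U)) \<and>
     (\<forall>A\<in>U. A \<noteq> 0 \<longrightarrow> invertible A)"

definition spread_of_set :: "('f::field^'n::finite^'n) set \<Rightarrow> ('f^('n + 'n)) set set" where
  "spread_of_set U = insert infinity_space (graph_space ` U)"

definition symplectic_isometry ::
  "('f::field^('n::finite + 'n) \<Rightarrow> 'f^('n + 'n)) \<Rightarrow> bool" where
  "symplectic_isometry g \<longleftrightarrow> Vector_Spaces.linear (*s) (*s) g \<and> bij g \<and>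
     (\<forall>x y. symplectic_form (g x) (g y) = symplectic_form x y)"

definition semifield_spread :: "('f::{field,finite}^('n::finite + 'n)) set set \<Rightarrow> bool" where
  "semifield_spread D \<longleftrightarrow> spread symplectic_polar_space D \<and>
     (\<exists>U g. linear_spread_set U \<and> symplectic_isometry g \<and> D = (\<lambda>S. g ` S) ` spread_of_set U)"

(* The inclusion of F_q in F_(q^2) is given by an arbitrary homomorphism of fields,
   which is automatically injective. *)
definition field_embedding :: "('k::field \<Rightarrow> 'f::field) \<Rightarrow> bool" where
  "field_embedding \<iota> \<longleftrightarrow> \<iota> 1 = 1 \<and>
     (\<forall>x y. \<iota> (x + y) = \<iota> x + \<iota> y) \<and> (\<forall>x y. \<iota> (x * y) = \<iota> x * \<iota> y)"

definition extend_scalars ::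
  "('k::field \<Rightarrow> 'f::field) \<Rightarrow> ('k^'m::finite) set \<Rightarrow> ('f^'m) set" where
  "extend_scalars \<iota> S = vec.span ((\<lambda>x. \<chi> i. \<iota> (x $ i)) ` S)"

definition spread_extension ::
  "('k::field \<Rightarrow> 'f::field) \<Rightarrow> ('k^'m::finite) set set \<Rightarrow> ('f^'m) set set" where
  "spread_extension \<iota> D = extend_scalars \<iota> ` D"

end

theory Submission
  imports Defs "HOL-Number_Theory.Residues"
begin

text \<open>
  An isotropic subspace of dimension \<open>n\<close> disjoint from \<open>S\<^sub>\<infinity>\<close> is \<open>S\<^sub>M\<close> for a hermitian matrix \<open>M\<close>, so
  one has to show that \<open>M + A\<close> cannot be invertible for every \<open>A\<close> in the spread set \<open>U\<close>. All these
  determinants lie in \<open>F\<^sub>q\<close>, so if none vanished then \<open>det (M + A)\<close> raised to the power \<open>q - 1\<close> would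
  be constantly \<open>1\<close>, with sum \<open>q\<^sup>n = 0\<close> over \<open>U\<close>. On the other hand, with \<open>q = p\<^sup>e\<close> and
  \<open>q - 1 = (p - 1)(1 + p + \<dots> + p\<^sup>e\<^sup>-\<^sup>1)\<close>, this power expands into products of \<open>n e (p - 1)\<close> factors, each
  an additive map of \<open>A\<close> plus a constant. As \<open>U\<close> is elementary abelian of rank \<open>n e\<close>, a product of
  fewer than \<open>n e (p - 1)\<close> additive maps sums to zero over \<open>U\<close>, as in the proof of the
  Chevalley--Warning theorem. Hence the sum does not depend on \<open>M\<close>; but for \<open>M = 0\<close> it equals
  \<open>q\<^sup>n - 1 = -1\<close>.
\<close>

subsection \<open>Sums of products of additive maps\<close>

text \<open>Telescoping (c+1)^(j+1) - c^(j+1) over all c < p gives p^(j+1) = 0. In the binomial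
  expansion, induction kills the terms with k < j, which leaves j+1 times the wanted sum; and j+1 <
  p is nonzero in the field.\<close>

lemma sum_power_of_nat_eq_0:
  assumes "prime CHAR('a::field)" "j < CHAR('a) - 1"
  shows "(\<Sum>c<CHAR('a). (of_nat c :: 'a) ^ j) = 0"
  using assms(2)
proof (induction j rule: less_induct)
  case (less j)
  let ?p = "CHAR('a)"
  have "of_nat (c + 1) ^ Suc j - of_nat c ^ Suc j =
      (\<Sum>k\<le>j. of_nat (Suc j choose k) * (of_nat c :: 'a) ^ k)" for c
    using binomial_ring[of "of_nat c :: 'a" 1 "Suc j"] by (simp add: add.commute)
  then have "(\<Sum>c<?p. \<Sum>k\<le>j. of_nat (Suc j choose k) * (of_nat c :: 'a) ^ k) =
      (\<Sum>c<?p. of_nat (Suc c) ^ Suc j - of_nat c ^ Suc j)"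
    by simp
  also have "\<dots> = of_nat ?p ^ Suc j - of_nat 0 ^ Suc j"
    by (rule sum_lessThan_telescope)
  also have "\<dots> = 0"
    by simp
  also have "(\<Sum>c<?p. \<Sum>k\<le>j. of_nat (Suc j choose k) * (of_nat c :: 'a) ^ k) =
      (\<Sum>k\<le>j. of_nat (Suc j choose k) * (\<Sum>c<?p. (of_nat c :: 'a) ^ k))"
    by (subst sum.swap) (simp add: sum_distrib_left)
  also have "\<dots> = of_nat (Suc j choose j) * (\<Sum>c<?p. (of_nat c :: 'a) ^ j)"
    by (rule sum.remove[where x = j, THEN trans]) (use less in auto)
  finally have "of_nat (Suc j) * (\<Sum>c<?p. (of_nat c :: 'a) ^ j) = 0"
    by simp
  moreover have "of_nat (Suc j) \<noteq> (0 :: 'a)"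
    unfolding of_nat_eq_0_iff_char_dvd using less.prems by (auto dest!: dvd_imp_le)
  ultimately show ?case
    by (metis mult_eq_0_iff)
qed

text \<open>The count \<open>N\<close> and the vanishing are obtained together, by adjoining one element \<open>v\<close> at a
  time: the sum over a coset line factors into a sum over the smaller subgroup and a power sum
  over the prime field, and one of the two factors has too small a degree.\<close>

lemma (in vector_space) additive_subgroup_sum_prod_eq_0:
  fixes V :: "'b set"
  assumes "finite V" "0 \<in> V" and add: "\<And>x y. x \<in> V \<Longrightarrow> y \<in> V \<Longrightarrow> x + y \<in> V"
    and prime: "prime CHAR('a)"
  obtains N where "card V = CHAR('a) ^ N"
    and "\<And>(J :: 'i set) \<phi>. finite J \<Longrightarrow> card J < N * (CHAR('a) - 1) \<Longrightarrow>
      (\<And>j x y. j \<in> J \<Longrightarrow> \<phi> j (x + y) = \<phi> j x + \<phi> j y) \<Longrightarrow> (\<Sum>x\<in>V. \<Prod>j\<in>J. \<phi> j x) = (0 :: 'a)"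
proof -
  let ?p = "CHAR('a)"
  \<comment> \<open>Additively closed subsets satisfying both claims are collected in
    \<open>good\<close>. A maximal one must be all of \<open>V\<close>, since otherwise adjoining
    one element gives a larger one.\<close>
  define P where "P = (\<lambda>(W :: 'b set) N. card W = ?p ^ N \<and>
    (\<forall>(J :: 'i set) \<phi>. finite J \<longrightarrow> card J < N * (?p - 1) \<longrightarrow>
      (\<forall>j\<in>J. \<forall>x y. \<phi> j (x + y) = \<phi> j x + \<phi> j y) \<longrightarrow> (\<Sum>x\<in>W. \<Prod>j\<in>J. \<phi> j x) = (0 :: 'a)))"
  define good where "good = {W. W \<subseteq> V \<and> 0 \<in> W \<and> (\<forall>x\<in>W. \<forall>y\<in>W. x + y \<in> W) \<and> (\<exists>N. P W N)}"
  \<comment> \<open>For exponent 0 no \<open>J\<close> is small enough, so the vanishing claim is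
    vacuous.\<close>
  have "P {0} 0"
    by (auto simp: P_def)
  then have "{0} \<in> good"
    using assms by (auto simp: good_def)
  moreover have "finite good"
    by (rule finite_subset[of _ "Pow V"]) (use assms in \<open>auto simp: good_def\<close>)
  ultimately obtain W where W: "W \<in> good" and max: "\<And>W'. W' \<in> good \<Longrightarrow> W \<subseteq> W' \<Longrightarrow> W = W'"
    using finite_has_maximal[of good] by blast
  from W have sub: "W \<subseteq> V" "0 \<in> W" and Wadd: "\<And>x y. x \<in> W \<Longrightarrow> y \<in> W \<Longrightarrow> x + y \<in> W"
    by (auto simp: good_def)
  from W obtain N where N: "P W N"
    by (auto simp: good_def)
  have mult: "scale (of_nat c) x \<in> A" if "0 \<in> A" "\<And>x y. x \<in> A \<Longrightarrow> y \<in> A \<Longrightarrow> x + y \<in> A" "x \<in> A"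
    for c x A
    by (induction c) (use that in \<open>auto simp: scale_left_distrib\<close>)
  \<comment> \<open>Closure under addition yields negatives because (p-1)x = -x in characteristic
    p.\<close>
  have neg: "- x \<in> W" if "x \<in> W" for x
  proof -
    have "scale (of_nat (?p - 1)) x = - x"
      using prime_gt_0_nat[OF prime] by (simp add: of_nat_diff)
    with mult[of W x "?p - 1"] sub Wadd that show ?thesis by auto
  qed
  have "W = V"
  proof (rule ccontr)
    assume "W \<noteq> V"
    then obtain v where v: "v \<in> V" "v \<notin> W" using sub by blast
    define f where "f = (\<lambda>(x, c::nat). x + scale (of_nat c) v)"
    define W' where "W' = f ` (W \<times> {..<?p})"
    \<comment> \<open>Only c mod p matters, so arbitrary natural coefficients are allowed; closure
      of \<open>W'\<close> under addition rests on this.\<close>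
    have f_mem: "f (x, c) \<in> W'" if "x \<in> W" for x c
    proof -
      have "of_nat c = (of_nat (c mod ?p) :: 'a)"
        by (metis cong_def mod_mod_trivial of_nat_eq_iff_cong_CHAR)
      then have "f (x, c) = f (x, c mod ?p)" by (simp add: f_def)
      then show ?thesis
        using that prime_gt_0_nat[OF prime] unfolding W'_def by auto
    qed
    \<comment> \<open>A coincidence with c < d < p puts (d-c)v into \<open>W\<close>. As d-c is
      invertible modulo p, v itself would lie in \<open>W\<close>.\<close>
    have no: "False" if "x \<in> W" "y \<in> W" "x + scale (of_nat c) v = y + scale (of_nat d) v" "c < d" "d < ?p"
      for x y c d
    proof -
      have "\<not> ?p dvd d - c" using that by (auto dest!: dvd_imp_le)
      then have "coprime (d - c) ?p"
        using prime by (metis coprime_commute prime_imp_coprime_nat)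
      then obtain m where "[(d - c) * m = 1] (mod ?p)"
        using cong_solve_coprime_nat by fastforce
      then have m: "of_nat m * of_nat (d - c) = (1 :: 'a)"
        by (metis mult.commute of_nat_1 of_nat_eq_iff_cong_CHAR of_nat_mult)
      have "x - y = scale (of_nat (d - c)) v"
        using that by (simp add: of_nat_diff scale_left_diff_distrib algebra_simps)
      then have "scale (of_nat m) (x - y) = v"
        by (metis m scale_one scale_scale)
      moreover have "x - y \<in> W" using Wadd[OF that(1) neg[OF that(2)]] by simp
      ultimately show False using mult[of W "x - y" m] sub Wadd v by metis
    qed
    have inj: "inj_on f (W \<times> {..<?p})"
    proof (rule inj_onI, clarsimp simp: f_def)
      fix x c y d
      assume *: "x \<in> W" "y \<in> W" "x + scale (of_nat c) v = y + scale (of_nat d) v" "c < ?p" "d < ?p"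
      have "c = d" using no[of x y c d] no[of y x d c] * by (metis linorder_neqE_nat)
      with * show "x = y \<and> c = d" by simp
    qed
    have "card W' = ?p ^ Suc N"
      using N unfolding W'_def by (simp add: card_image[OF inj] card_cartesian_product P_def)
    moreover have "(\<Sum>x\<in>W'. \<Prod>j\<in>J. \<phi> j x) = 0"
      if J: "finite J" "card J < Suc N * (?p - 1)"
        and \<phi>: "\<And>j x y. j \<in> J \<Longrightarrow> \<phi> j (x + y) = \<phi> j x + \<phi> j y"
      for J :: "'i set" and \<phi> :: "'i \<Rightarrow> 'b \<Rightarrow> 'a"
    proof -
      have \<phi>0: "\<phi> j 0 = 0" if "j \<in> J" for j
        using \<phi>[OF that, of 0 0] by (metis add.right_neutral add_left_cancel)
      have \<phi>_nat: "\<phi> j (scale (of_nat c) x) = of_nat c * \<phi> j x" if "j \<in> J" for j c x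
        by (induction c) (use \<phi> \<phi>0 that in \<open>auto simp: scale_left_distrib algebra_simps\<close>)
      have "(\<Sum>x\<in>W'. \<Prod>j\<in>J. \<phi> j x) = (\<Sum>(x,c)\<in>W \<times> {..<?p}. \<Prod>j\<in>J. \<phi> j (f (x, c)))"
        unfolding W'_def by (simp add: sum.reindex[OF inj] case_prod_unfold)
      \<comment> \<open>\<open>X\<close> is the set of factors that contribute their
        \<open>x\<close> part; the other factors contribute c times a constant, which gives a power
        of c with exponent \<open>card (J - X)\<close>.\<close>
      also have "\<dots> = (\<Sum>(x,c)\<in>W \<times> {..<?p}. \<Sum>X\<in>Pow J. (\<Prod>j\<in>X. \<phi> j x) *
          (of_nat c ^ card (J - X) * (\<Prod>j\<in>J - X. \<phi> j v)))"
      proof (intro sum.cong refl, clarify)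
        fix x c
        have "(\<Prod>j\<in>J. \<phi> j (f (x, c))) = (\<Prod>j\<in>J. \<phi> j x + of_nat c * \<phi> j v)"
          by (intro prod.cong) (auto simp: f_def \<phi> \<phi>_nat)
        then show "(\<Prod>j\<in>J. \<phi> j (f (x, c))) = (\<Sum>X\<in>Pow J. (\<Prod>j\<in>X. \<phi> j x) *
          (of_nat c ^ card (J - X) * (\<Prod>j\<in>J - X. \<phi> j v)))"
          using J(1) by (simp add: prod_add prod.distrib)
      qed
      also have "\<dots> = (\<Sum>X\<in>Pow J. \<Sum>(x,c)\<in>W \<times> {..<?p}. (\<Prod>j\<in>X. \<phi> j x) *
          (of_nat c ^ card (J - X) * (\<Prod>j\<in>J - X. \<phi> j v)))"
        unfolding case_prod_unfold by (rule sum.swap)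
      also have "\<dots> = (\<Sum>X\<in>Pow J. (\<Sum>x\<in>W. \<Prod>j\<in>X. \<phi> j x) *
          (\<Sum>c<?p. of_nat c ^ card (J - X) * (\<Prod>j\<in>J - X. \<phi> j v)))"
        unfolding sum_product sum.cartesian_product ..
      also have "\<dots> = 0"
      proof (rule sum.neutral, intro ballI)
        fix X assume "X \<in> Pow J"
        then have X: "X \<subseteq> J" "finite X" using J(1) finite_subset by auto
        show "(\<Sum>x\<in>W. \<Prod>j\<in>X. \<phi> j x) *
            (\<Sum>c<?p. of_nat c ^ card (J - X) * (\<Prod>j\<in>J - X. \<phi> j v)) = 0"
        proof (cases "card X < N * (?p - 1)")
          case True
          then have "(\<Sum>x\<in>W. \<Prod>j\<in>X. \<phi> j x) = 0"
            using N X \<phi> unfolding P_def by blast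
          then show ?thesis by simp
        next
          case False
          \<comment> \<open>Of fewer than (N+1)(p-1) factors, at least N(p-1) went into
            \<open>X\<close>.\<close>
          then have "card (J - X) < ?p - 1"
            using J X card_mono[OF J(1) X(1)] by (simp add: card_Diff_subset)
          then show ?thesis
            using sum_power_of_nat_eq_0[OF prime] by (simp flip: sum_distrib_right)
        qed
      qed
      finally show ?thesis .
    qed
    ultimately have "P W' (Suc N)"
      unfolding P_def by blast
    moreover have "x + y \<in> W'" if xy: "x \<in> W'" "y \<in> W'" for x y
    proof -
      obtain x' c where x: "x = f (x', c)" "x' \<in> W"
        using xy(1) by (auto simp: W'_def)
      obtain y' d where y: "y = f (y', d)" "y' \<in> W"
        using xy(2) by (auto simp: W'_def)
      have "x + y = f (x' + y', c + d)" "x' + y' \<in> W"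
        using x y Wadd by (auto simp: f_def scale_left_distrib algebra_simps)
      then show ?thesis using f_mem by metis
    qed
    moreover have "W' \<subseteq> V"
      using add[OF _ mult[OF assms(2) add v(1)]] sub(1) by (auto simp: W'_def f_def)
    moreover have WW: "W \<subseteq> W'" using f_mem[of _ 0] by (auto simp: f_def)
    ultimately have "W' \<in> good" using sub unfolding good_def by blast
    from max[OF this WW] f_mem[OF sub(2), of 1] v show False by (simp add: f_def)
  qed
  with N show thesis unfolding P_def by (intro that[of N]) auto
qed

text \<open>Expanding over subsets of \<open>J\<close>, each proper subset gives a product of fewer
  than N(p-1) additive maps, whose sum vanishes. The full set survives, and its term is free of the
  constants \<open>k j\<close>. Hence the bound on \<open>card J\<close> may be attained.\<close>

lemma (in vector_space) additive_subgroup_sum_prod_shift: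
  fixes V :: "'b set" and J :: "'i set" and \<phi> :: "'i \<Rightarrow> 'b \<Rightarrow> 'a"
  assumes "finite V" "0 \<in> V" "\<And>x y. x \<in> V \<Longrightarrow> y \<in> V \<Longrightarrow> x + y \<in> V"
    and prime: "prime CHAR('a)" and "card V = CHAR('a) ^ N"
    and J: "finite J" "card J \<le> N * (CHAR('a) - 1)"
    and \<phi>: "\<And>j x y. j \<in> J \<Longrightarrow> \<phi> j (x + y) = \<phi> j x + \<phi> j y"
  shows "(\<Sum>x\<in>V. \<Prod>j\<in>J. \<phi> j x + k j) = (\<Sum>x\<in>V. \<Prod>j\<in>J. \<phi> j x)"
proof -
  obtain N' where N': "card V = CHAR('a) ^ N'"
    and sum_0: "\<And>(J :: 'i set) \<phi>. finite J \<Longrightarrow> card J < N' * (CHAR('a) - 1) \<Longrightarrow>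
      (\<And>j x y. j \<in> J \<Longrightarrow> \<phi> j (x + y) = \<phi> j x + \<phi> j y) \<Longrightarrow> (\<Sum>x\<in>V. \<Prod>j\<in>J. \<phi> j x) = (0 :: 'a)"
    using additive_subgroup_sum_prod_eq_0[OF assms(1-4), where ?'i = 'i] by blast
  have "N' = N"
    using N' assms(5) prime_gt_1_nat[OF prime] by simp
  have "(\<Sum>x\<in>V. \<Prod>j\<in>J. \<phi> j x + k j) =
      (\<Sum>X\<in>Pow J. (\<Sum>x\<in>V. \<Prod>j\<in>X. \<phi> j x) * (\<Prod>j\<in>J - X. k j))"
    by (simp add: prod_add[OF J(1)] sum.swap[of _ _ V] sum_distrib_right)
  also have "\<dots> = (\<Sum>X\<in>{J}. (\<Sum>x\<in>V. \<Prod>j\<in>X. \<phi> j x) * (\<Prod>j\<in>J - X. k j))"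
  proof (intro sum.mono_neutral_right ballI)
    fix X assume "X \<in> Pow J - {J}"
    then have X: "X \<subset> J" by auto
    then have "card X < N' * (CHAR('a) - 1)"
      using psubset_card_mono[OF J(1) X] J(2) \<open>N' = N\<close> by simp
    then have "(\<Sum>x\<in>V. \<Prod>j\<in>X. \<phi> j x) = 0"
      using sum_0[of X \<phi>] X \<phi> finite_subset[of X J] J(1) by blast
    then show "(\<Sum>x\<in>V. \<Prod>j\<in>X. \<phi> j x) * (\<Prod>j\<in>J - X. k j) = 0"
      by simp
  qed (use J in auto)
  finally show ?thesis by simp
qed

section \<open>Powers of determinants as sums of products of additive maps\<close>

lemma prod_frobenius_powers:
  fixes x :: "'a::comm_monoid_mult"
  assumes "p > 0"
  shows "(\<Prod>i\<in>{..<e} \<times> {..<p - 1}. x ^ p ^ fst i) = x ^ (p ^ e - 1)"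
  unfolding prod.cartesian_product'
proof (induction e)
  case (Suc e)
  have "p ^ e - 1 + p ^ e * (p - 1) = p ^ Suc e - 1"
    using assms by (simp add: right_diff_distrib' mult.commute)
  with Suc show ?case
    by (simp flip: power_add power_mult)
qed simp

text \<open>Raising to a power of the characteristic is additive, so it passes through the Leibniz
  expansion. Each factor becomes a Frobenius power of an entry, which is additive in the
  matrix.\<close>

lemma det_power_CHAR_power:
  fixes A :: "'a::field^'n^'n"
  assumes "prime CHAR('a)"
  shows "det A ^ CHAR('a) ^ m =
    (\<Sum>\<sigma>\<in>{\<sigma>. \<sigma> permutes UNIV}. of_int (sign \<sigma>) ^ CHAR('a) ^ m * (\<Prod>r\<in>UNIV. (A $ r $ \<sigma> r) ^ CHAR('a) ^ m))"
  unfolding det_def freshmans_dream_sum'[OF assms refl]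
  by (simp add: power_mult_distrib prod_power_distrib)

text \<open>Once a permutation is chosen for each index in \<open>I\<close>, the term is a product
  of n e (p-1) maps additive in \<open>A\<close>. Since \<open>V\<close> has p^(n e) elements, this
  is exactly the largest number of factors that the shift lemma permits.\<close>

lemma sum_det_shift:
  fixes V :: "('a::field^'n^'n) set"
  assumes "finite V" "0 \<in> V" "\<And>A B. A \<in> V \<Longrightarrow> B \<in> V \<Longrightarrow> A + B \<in> V"
    and prime: "prime CHAR('a)" and q: "q = CHAR('a) ^ e" and "card V = q ^ CARD('n)"
  shows "(\<Sum>A\<in>V. det (A + M) ^ (q - 1)) = (\<Sum>A\<in>V. det A ^ (q - 1))"
proof -
  let ?p = "CHAR('a)"
  define I where "I = {..<e} \<times> {..<?p - 1}"
  define S where "S = {\<sigma> :: 'n \<Rightarrow> 'n. \<sigma> permutes UNIV}"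
  define s where "s g = (\<Prod>i\<in>I. of_int (sign (g i)) ^ ?p ^ fst i :: 'a)"
    for g :: "nat \<times> nat \<Rightarrow> 'n \<Rightarrow> 'n"
  have "finite I" "finite S" by (simp_all add: I_def S_def)
  have expand: "det A ^ (q - 1) = (\<Sum>g\<in>PiE I (\<lambda>_. S). s g *
      (\<Prod>j\<in>I \<times> UNIV. (A $ snd j $ g (fst j) (snd j)) ^ ?p ^ fst (fst j)))" for A :: "'a^'n^'n"
  proof -
    \<comment> \<open>The first component of an index in \<open>I\<close> is the Frobenius exponent;
      the second only counts the p-1 repetitions.\<close>
    have "det A ^ (q - 1) = (\<Prod>i\<in>I. det A ^ ?p ^ fst i)"
      unfolding I_def q by (rule prod_frobenius_powers[symmetric]) (use prime prime_gt_0_nat in auto)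
    then show ?thesis
      unfolding det_power_CHAR_power[OF prime] S_def[symmetric]
        prod_sum_PiE[OF \<open>finite I\<close> \<open>finite S\<close>]
      by (simp add: prod.distrib s_def prod.cartesian_product case_prod_unfold)
  qed
  have card_V: "card V = ?p ^ (e * CARD('n))"
    using assms by (simp add: power_mult)
  \<comment> \<open>Entrywise scaling by field elements makes the matrices a vector space, the
    setting of the shift lemma. \<open>V\<close> itself is only known to be closed under
    addition.\<close>
  interpret vector_space "\<lambda>c. map_matrix ((*) (c :: 'a)) :: 'a^'n^'n \<Rightarrow> _"
    by unfold_locales (simp_all add: vec_eq_iff algebra_simps)
  have "(\<Sum>A\<in>V. \<Prod>j\<in>I \<times> UNIV. ((A + M) $ snd j $ g (fst j) (snd j)) ^ ?p ^ fst (fst j)) =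
      (\<Sum>A\<in>V. \<Prod>j\<in>I \<times> UNIV. (A $ snd j $ g (fst j) (snd j)) ^ ?p ^ fst (fst j))"
    for g :: "nat \<times> nat \<Rightarrow> 'n \<Rightarrow> 'n"
    using additive_subgroup_sum_prod_shift[OF assms(1-3) prime card_V, of "I \<times> UNIV"
        "\<lambda>j A. (A $ snd j $ g (fst j) (snd j)) ^ ?p ^ fst (fst j)"
        "\<lambda>j. (M $ snd j $ g (fst j) (snd j)) ^ ?p ^ fst (fst j)"] \<open>finite I\<close>
    by (simp add: freshmans_dream'[OF prime refl] card_cartesian_product I_def mult_ac)
  then show ?thesis
    unfolding expand sum.swap[of _ _ V] sum_distrib_left[symmetric] by simp
qed

text \<open>The equation x^q = x expresses membership in F_q without naming a subfield. It gives
  x^(q-1) = 1 for nonzero x, so the power sums count nonzero determinants modulo p.\<close>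

theorem exists_singular_translate:
  fixes V :: "('a::field^'n^'n) set"
  assumes "finite V" "0 \<in> V" "\<And>A B. A \<in> V \<Longrightarrow> B \<in> V \<Longrightarrow> A + B \<in> V"
    and prime: "prime CHAR('a)" and q: "q = CHAR('a) ^ e" "e > 0" and card: "card V = q ^ CARD('n)"
    and inv: "\<And>A. A \<in> V \<Longrightarrow> A \<noteq> 0 \<Longrightarrow> det A \<noteq> 0"
    and fix_V: "\<And>A. A \<in> V \<Longrightarrow> det A ^ q = det A"
    and fix_M: "\<And>A. A \<in> V \<Longrightarrow> det (A + M) ^ q = det (A + M)"
  shows "\<exists>A\<in>V. det (A + M) = 0"
proof (rule ccontr)
  assume nz: "\<not> ?thesis"
  have "q > 1"
    using q prime_gt_1_nat[OF prime] by (metis one_less_power)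
  have power_1: "x ^ (q - 1) = 1" if "x \<noteq> 0" "x ^ q = x" for x :: 'a
    using that power_minus_mult[of q x] \<open>q > 1\<close> by simp
  \<comment> \<open>Matrices have at least one row, so \<open>card V\<close>, a positive power of
    \<open>q\<close>, is zero in the field as well.\<close>
  have q_0: "of_nat q = (0 :: 'a)"
    using q by (simp add: of_nat_eq_0_iff_char_dvd)
  have "(\<Sum>A\<in>V. det (A + M) ^ (q - 1)) = (\<Sum>A\<in>V. 1)"
    by (intro sum.cong refl power_1) (use nz fix_M in auto)
  then have "(\<Sum>A\<in>V. det (A + M) ^ (q - 1)) = 0"
    using q_0 by (simp add: card power_0_left)
  then have "0 = (\<Sum>A\<in>V. det A ^ (q - 1))"
    using sum_det_shift[OF assms(1-4) q(1) card] by simp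
  also have "\<dots> = det (0 :: 'a^'n^'n) ^ (q - 1) + (\<Sum>A\<in>V - {0}. det A ^ (q - 1))"
    by (rule sum.remove) (use assms in auto)
  also have "(\<Sum>A\<in>V - {0}. det A ^ (q - 1)) = (\<Sum>A\<in>V - {0}. 1)"
    by (intro sum.cong refl power_1) (use inv fix_V in auto)
  \<comment> \<open>The zero matrix contributes 0^(q-1), which is 0 because q > 1.\<close>
  also have "det (0 :: 'a^'n^'n) ^ (q - 1) + \<dots> = (\<Sum>A\<in>V - {0}. 1)"
    using det_0[where ?'a = 'a and ?'n = 'n] \<open>q > 1\<close> by (simp add: power_0_left)
  also have "\<dots> = of_nat (card V) - 1"
    using assms(1,2) card_gt_0_iff[of V] by (auto simp: card_Diff_singleton of_nat_diff Suc_le_eq)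
  also have "\<dots> = - 1"
    using q_0 by (simp add: card power_0_left)
  finally show False by simp
qed

subsection \<open>Extension of scalars\<close>

text \<open>Multiplication by a nonzero x permutes the nonzero elements; comparing their products
  gives x^(q-1) = 1, where q is the order of the field.\<close>

lemma field_power_card:
  fixes x :: "'a::{field,finite}"
  shows "x ^ CARD('a) = x"
proof (cases "x = 0")
  case False
  have "prod ((*) x) (UNIV - {0}) = \<Prod>(UNIV - {0})"
    by (rule prod.reindex_bij_witness[of _ "\<lambda>y. y / x" "(*) x"]) (use False in auto)
  then have "x ^ (CARD('a) - 1) * \<Prod>(UNIV - {0}) = 1 * \<Prod>(UNIV - {0 :: 'a})"
    by (simp add: prod.distrib card_Diff_singleton)
  then have "x ^ (CARD('a) - 1) = 1"
    by simp
  then show ?thesis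
    using power_minus_mult[of "CARD('a)" x] by simp
qed simp

text \<open>The entrywise map inside \<open>extend_scalars\<close>. It serves both the inclusion of
  F_q and conjugation, each of which is a \<open>field_embedding\<close>.\<close>

definition map_vec :: "('a \<Rightarrow> 'b) \<Rightarrow> 'a^'n \<Rightarrow> 'b^'n" where
  "map_vec h x = (\<chi> i. h (x $ i))"

lemma map_vec_nth [simp]: "map_vec h x $ i = h (x $ i)"
  by (simp add: map_vec_def)

context
  fixes h :: "'k::field \<Rightarrow> 'f::field"
  assumes h: "field_embedding h"
begin

lemma field_embedding_add: "h (x + y) = h x + h y"
  and field_embedding_mult: "h (x * y) = h x * h y"
  and field_embedding_1: "h 1 = 1"
  using h by (auto simp: field_embedding_def)

lemma field_embedding_0: "h 0 = 0"
  using field_embedding_add[of 0 0] by (metis add.right_neutral add_left_cancel)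

lemma field_embedding_minus: "h (- x) = - h x"
  using field_embedding_add[of x "- x"] by (simp add: field_embedding_0 eq_neg_iff_add_eq_0 add.commute)

lemma field_embedding_diff: "h (x - y) = h x - h y"
  using field_embedding_add[of x "- y"] by (simp add: field_embedding_minus)

lemma field_embedding_sum: "h (sum f A) = (\<Sum>x\<in>A. h (f x))"
  by (induction A rule: infinite_finite_induct) (auto simp: field_embedding_add field_embedding_0)

lemma field_embedding_prod: "h (prod f A) = (\<Prod>x\<in>A. h (f x))"
  by (induction A rule: infinite_finite_induct) (auto simp: field_embedding_mult field_embedding_1)

lemma field_embedding_power: "h (x ^ n) = h x ^ n"
  by (induction n) (auto simp: field_embedding_mult field_embedding_1)

lemma field_embedding_eq_0_iff: "h x = 0 \<longleftrightarrow> x = 0"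
proof
  assume "h x = 0"
  then have "h (x * inverse x) = 0" by (simp add: field_embedding_mult)
  then show "x = 0" using field_embedding_1 by (cases "x = 0") auto
qed (simp add: field_embedding_0)

lemma field_embedding_inj: "inj h"
  by (rule injI) (metis field_embedding_diff field_embedding_eq_0_iff eq_iff_diff_eq_0)

text \<open>For conjugation this puts determinants of hermitian matrices into F_q; for the inclusion
  it preserves invertibility.\<close>

lemma det_map_matrix:
  fixes A :: "'k^'n^'n"
  shows "det (map_matrix h A) = h (det A)"
proof -
  have "h (of_int (sign \<sigma>)) = of_int (sign \<sigma>)" for \<sigma> :: "'n \<Rightarrow> 'n"
    by (cases \<sigma> rule: sign_cases) (auto simp: field_embedding_1 field_embedding_minus)
  then show ?thesis
    by (simp add: det_def field_embedding_sum field_embedding_mult field_embedding_prod)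
qed

lemma map_vec_matrix_vector_mult: "map_vec h (A *v x) = map_matrix h A *v map_vec h x"
  by (simp add: vec_eq_iff matrix_vector_mult_def field_embedding_sum field_embedding_mult)

lemma map_matrix_matrix_mult: "map_matrix h (A ** B) = map_matrix h A ** map_matrix h B"
  by (simp add: vec_eq_iff matrix_matrix_mult_def field_embedding_sum field_embedding_mult)

lemma map_matrix_mat_1: "map_matrix h (mat 1) = mat 1"
  by (simp add: vec_eq_iff mat_def field_embedding_0 field_embedding_1)

text \<open>Naturality of scalar extension: spans commute with linear images. It is applied to the
  parametrisations of the spread elements and to isometries.\<close>

lemma extend_scalars_image:
  fixes L' :: "'f^'m \<Rightarrow> 'f^'l"
  assumes "Vector_Spaces.linear (*s) (*s) L'" "\<And>x. map_vec h (L x) = L' (map_vec h x)"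
  shows "extend_scalars h (L ` S) = L' ` extend_scalars h S"
  unfolding extend_scalars_def map_vec_def[symmetric] vec.linear_span_image[OF assms(1), symmetric]
  by (simp add: image_image assms(2))

lemma extend_scalars_UNIV: "extend_scalars h (UNIV :: ('k^'m::finite) set) = UNIV"
proof -
  have "axis i 1 = map_vec h (axis i 1)" for i :: 'm
    by (simp add: vec_eq_iff axis_def field_embedding_0 field_embedding_1)
  then have "(cart_basis :: ('f^'m) set) \<subseteq> range (map_vec h)"
    unfolding cart_basis_def by blast
  then show ?thesis
    unfolding extend_scalars_def map_vec_def[symmetric]
    using vec.span_mono[of cart_basis "range (map_vec h)"] vec.span_Basis by auto
qed

end

subsection \<open>The forms and the subspaces in block coordinates\<close>

lemma sum_UNIV_sum: "(\<Sum>i\<in>UNIV. f i) = (\<Sum>i\<in>UNIV. f (Inl i)) + (\<Sum>i\<in>UNIV. f (Inr i))"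
  for f :: "'a::finite + 'b::finite \<Rightarrow> 'c::comm_monoid_add"
  by (simp add: sum.Plus flip: UNIV_Plus_UNIV)

lemma block_vec_nth [simp]: "block_vec u v $ Inl i = u $ i" "block_vec u v $ Inr i = v $ i"
  by (simp_all add: block_vec_def)

lemma block_vec_eq_iff: "x = y \<longleftrightarrow> (\<forall>i. x $ Inl i = y $ Inl i) \<and> (\<forall>i. x $ Inr i = y $ Inr i)"
  for x y :: "'f^('n::finite + 'm::finite)"
  by (simp add: vec_eq_iff split_sum_all)

lemma symplectic_form_eq:
  "symplectic_form x y =
    (\<Sum>i\<in>UNIV. x $ Inl i * y $ Inr i) - (\<Sum>i\<in>UNIV. x $ Inr i * y $ Inl i)"
  by (simp add: symplectic_form_def block_mat_def sum_UNIV_sum mat_def if_distrib if_distribR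
      sum_negf sum.delta cong: if_cong)

text \<open>Reduces computations with the hermitian form to the bilinear symplectic form.\<close>

lemma hermitian_form_eq: "hermitian_form q a x y = a * symplectic_form x (map_vec (\<lambda>c. c ^ q) y)"
  unfolding hermitian_form_def symplectic_form_def sum_distrib_left
  by (intro sum.cong refl) (auto simp: block_mat_def mat_def split: sum.split)

lemma symplectic_form_map_vec:
  assumes "field_embedding h"
  shows "symplectic_form (map_vec h x) (map_vec h y) = h (symplectic_form x y)"
  by (simp add: symplectic_form_eq field_embedding_sum[OF assms] field_embedding_mult[OF assms]
      field_embedding_diff[OF assms])

lemma symplectic_form_sum_left: "symplectic_form (\<Sum>k\<in>A. f k) y = (\<Sum>k\<in>A. symplectic_form (f k) y)"
  by (induction A rule: infinite_finite_induct)
    (auto simp: symplectic_form_eq sum.distrib algebra_simps)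

lemma symplectic_form_sum_right: "symplectic_form x (\<Sum>k\<in>A. f k) = (\<Sum>k\<in>A. symplectic_form x (f k))"
  by (induction A rule: infinite_finite_induct)
    (auto simp: symplectic_form_eq sum.distrib algebra_simps)

lemma symplectic_form_scale:
  "symplectic_form (c *s x) y = c * symplectic_form x y"
  "symplectic_form x (c *s y) = c * symplectic_form x y"
  by (auto simp: symplectic_form_eq sum_distrib_left algebra_simps)

text \<open>The pulled-back form depends only on the pairings of columns, so invariance can be
  carried to a larger field.\<close>

lemma symplectic_form_matrix:
  "symplectic_form (G *v x) (G *v y) =
    (\<Sum>k\<in>UNIV. \<Sum>l\<in>UNIV. x $ k * y $ l * symplectic_form (column k G) (column l G))"
  unfolding matrix_mult_sum symplectic_form_sum_left
  unfolding symplectic_form_sum_right symplectic_form_scale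
  by (simp add: mult_ac)

text \<open>Two different matrices are allowed because the hermitian form replaces the second one by
  its conjugate.\<close>

lemma symplectic_form_graph:
  "symplectic_form (block_vec u (M *v u)) (block_vec w (N *v w)) =
    (\<Sum>i\<in>UNIV. \<Sum>j\<in>UNIV. u $ i * w $ j * (N $ i $ j - M $ j $ i))"
proof -
  have "(\<Sum>i\<in>UNIV. (M *v u) $ i * w $ i) = (\<Sum>i\<in>UNIV. \<Sum>j\<in>UNIV. u $ i * w $ j * M $ j $ i)"
    unfolding matrix_vector_mult_def
    by (simp add: sum_distrib_right) (subst sum.swap, simp add: ac_simps)
  then show ?thesis
    by (simp add: symplectic_form_eq matrix_vector_mult_def sum_distrib_left sum_subtractf
        right_diff_distrib ac_simps)
qed

lemma linear_graph: "Vector_Spaces.linear (*s) (*s) (\<lambda>u. block_vec u (A *v u))"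
  for A :: "'f::field^'n^'n"
  unfolding Vector_Spaces.linear_iff
  by (auto simp: block_vec_eq_iff matrix_vector_right_distrib vector_scalar_commute
      vec.vector_space_axioms)

lemma linear_block_vec_0: "Vector_Spaces.linear (*s) (*s) (block_vec (0 :: 'f::field^'n))"
  unfolding Vector_Spaces.linear_iff by (auto simp: block_vec_eq_iff vec.vector_space_axioms)

lemma span_image_nonzero:
  fixes f :: "'f::field^'m \<Rightarrow> 'f^'l"
  assumes "Vector_Spaces.linear (*s) (*s) f"
  shows "vec.span {f u |u. u \<noteq> 0} = range f"
proof -
  have "f 0 = 0" using assms by (rule vec.linear_0)
  have "range f = insert (f 0) (f ` {u. u \<noteq> 0})"
    by (subst image_insert[symmetric]) (rule arg_cong[where f = "image f"], auto)
  also have "\<dots> = insert 0 {f u |u. u \<noteq> 0}"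
    unfolding \<open>f 0 = 0\<close> by blast
  finally have "range f = insert 0 {f u |u. u \<noteq> 0}" .
  moreover have "vec.span (range f) = range f"
    by (subst vec.linear_span_image[OF assms]) simp
  ultimately show ?thesis
    using vec.span_insert_0[of "{f u |u. u \<noteq> 0}"] by simp
qed

lemma graph_space_eq: "graph_space A = range (\<lambda>u. block_vec u (A *v u))"
  unfolding graph_space_def by (rule span_image_nonzero[OF linear_graph])

lemma infinity_space_eq: "infinity_space = range (block_vec 0)"
  unfolding infinity_space_def by (rule span_image_nonzero[OF linear_block_vec_0])

lemma subspace_graph_space: "vec.subspace (graph_space A)"
  unfolding graph_space_def by (rule vec.subspace_span)

lemma subspace_infinity_space: "vec.subspace infinity_space"
  unfolding infinity_space_def by (rule vec.subspace_span)

lemma dim_graph_space: "vec.dim (graph_space A) = CARD('n)" for A :: "'f::field^'n^'n"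
  unfolding graph_space_eq
  by (subst vec.dim_image_eq[OF linear_graph]) (auto simp: inj_on_def block_vec_eq_iff vec_eq_iff card_cart_basis)

lemma dim_infinity_space: "vec.dim (infinity_space :: ('f::field^('n::finite + 'n)) set) = CARD('n)"
  unfolding infinity_space_eq
  by (subst vec.dim_image_eq[OF linear_block_vec_0]) (auto simp: inj_on_def block_vec_eq_iff vec_eq_iff card_cart_basis)

lemma graph_space_Int_infinity_space: "graph_space A \<inter> infinity_space = {0}"
  unfolding graph_space_eq infinity_space_eq
  by (auto simp: block_vec_eq_iff vec_eq_iff image_iff)
    (metis matrix_vector_mult_0_right vec_eq_iff zero_index)+

lemma det_nonzero_iff: "det A \<noteq> 0 \<longleftrightarrow> (\<forall>u. A *v u = 0 \<longrightarrow> u = 0)" for A :: "'f::field^'n^'n"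
  unfolding invertible_det_nz[symmetric] invertible_left_inverse
  by (rule matrix_left_invertible_ker)

text \<open>Common vectors of the two graphs correspond to the kernel of
  \<open>A - B\<close>.\<close>

lemma graph_space_Int_graph_space_iff:
  "graph_space A \<inter> graph_space B = {0} \<longleftrightarrow> det (A - B) \<noteq> 0"
proof -
  have "graph_space A \<inter> graph_space B = {block_vec u (A *v u) |u. (A - B) *v u = 0}"
    unfolding graph_space_eq
    by (auto simp: block_vec_eq_iff matrix_vector_mult_diff_rdistrib image_iff simp flip: vec_eq_iff)
  moreover have "block_vec u (A *v u) = 0 \<longleftrightarrow> u = 0" for u
    by (auto simp: block_vec_eq_iff vec_eq_iff) (metis matrix_vector_mult_0_right vec_eq_iff zero_index)
  ultimately show ?thesis
    unfolding det_nonzero_iff by (auto simp: set_eq_iff)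
qed

text \<open>Projection to the first n coordinates is injective on \<open>T\<close>, its kernel being
  the space at infinity, hence onto by dimension. Preimages of the unit vectors supply the columns
  of \<open>M\<close>.\<close>

lemma ex_graph_space_subset:
  fixes T :: "('f::field^('n::finite + 'n)) set"
  assumes T: "vec.subspace T" "vec.dim T = CARD('n)" and disj: "T \<inter> infinity_space = {0}"
  shows "\<exists>M. graph_space M \<subseteq> T"
proof -
  define \<pi> :: "'f^('n + 'n) \<Rightarrow> 'f^'n" where "\<pi> x = (\<chi> i. x $ Inl i)" for x
  have lin: "Vector_Spaces.linear (*s) (*s) \<pi>"
    unfolding Vector_Spaces.linear_iff by (auto simp: vec_eq_iff \<pi>_def vec.vector_space_axioms)
  have "x = 0" if "x \<in> T" "\<pi> x = 0" for x
  proof -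
    have "x = block_vec 0 (\<chi> i. x $ Inr i)"
      using that by (simp add: block_vec_eq_iff \<pi>_def vec_eq_iff)
    then have "x \<in> infinity_space" unfolding infinity_space_eq by blast
    then show ?thesis using that disj by blast
  qed
  then have "inj_on \<pi> (vec.span T)"
    using T(1) by (simp add: vec.span_eq_iff[THEN iffD2] vec.linear_inj_on_iff_eq_0[OF lin])
  then have "vec.dim (\<pi> ` T) = CARD('n)"
    using vec.dim_image_eq[OF lin] T by metis
  then have "\<pi> ` T = UNIV"
    by (metis T(1) lin vec.dim_UNIV vec.linear_subspace_image vec.subspace_UNIV vec_dim_card
        vec.subspace_dim_equal subset_UNIV order_refl)
  then have "\<exists>t\<in>T. \<pi> t = axis j 1" for j
    by (metis UNIV_I imageE)
  then obtain t where t: "\<And>j. t j \<in> T" "\<And>j. \<pi> (t j) = axis j 1"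
    by metis
  have t_Inl: "t j $ Inl i = (if i = j then 1 else 0)" for i j
    using t(2)[of j] by (auto simp: \<pi>_def vec_eq_iff axis_def)
  define M :: "'f^'n^'n" where "M = (\<chi> i j. t j $ Inr i)"
  have "block_vec u (M *v u) = (\<Sum>j\<in>UNIV. u $ j *s t j)" for u
    by (simp add: block_vec_eq_iff M_def matrix_vector_mult_def t_Inl mult.commute if_distrib
        cong: if_cong)
  moreover have "(\<Sum>j\<in>UNIV. u $ j *s t j) \<in> T" for u
    using t(1) T(1) by (intro vec.subspace_sum vec.subspace_scale)
  ultimately show ?thesis
    unfolding graph_space_eq by (intro exI[of _ M]) auto
qed

subsection \<open>Maximality\<close>

lemma sum_axis_axis:
  "(\<Sum>k\<in>UNIV. \<Sum>l\<in>UNIV. axis i 1 $ k * axis j 1 $ l * f k l) = (f i j :: 'a::comm_semiring_1)"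
proof -
  have "axis i 1 $ k * axis j 1 $ l * f k l = (if k = i then if l = j then f k l else 0 else 0)" for k l
    by (simp add: axis_def)
  then show ?thesis by (simp add: if_distrib[of "sum _"] if_distribR sum.If_cases)
qed

locale quadratic_field_extension =
  fixes q :: nat and \<iota> :: "'k::{field,finite} \<Rightarrow> 'f::{field,finite}"
  assumes primepow_q: "primepow q"
    and card_k: "CARD('k) = q"
    and card_f: "CARD('f) = q ^ 2"
    and embedding: "field_embedding \<iota>"
begin

lemma prime_CHAR: "prime CHAR('f)"
  by (intro prime_CHAR_semidom finite_imp_CHAR_pos) simp

text \<open>The characteristic divides the order q^2, so it is the prime underlying
  \<open>q\<close>.\<close>

lemma q_eq_CHAR_power: obtains e where "q = CHAR('f) ^ e" "e > 0"
proof -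
  obtain p e where p: "prime p" "e > 0" "q = p ^ e"
    using primepow_q by (auto simp: primepow_def)
  have "CHAR('f) dvd p ^ (e * 2)"
    using CHAR_dvd_CARD[where 'a = 'f] p card_f by (simp add: power_mult)
  then have "CHAR('f) = p"
    using p(1) prime_CHAR by (metis prime_dvd_power primes_dvd_imp_eq)
  then show thesis using p that by blast
qed

definition conj :: "'f \<Rightarrow> 'f" where "conj x = x ^ q"

lemma field_embedding_conj: "field_embedding conj"
proof -
  obtain e where "q = CHAR('f) ^ e" by (rule q_eq_CHAR_power)
  from freshmans_dream'[OF prime_CHAR this] show ?thesis
    by (simp add: field_embedding_def conj_def power_mult_distrib)
qed

lemma conj_embedding: "conj (\<iota> x) = \<iota> x"
  using field_power_card[of x] field_embedding_power[OF embedding, of x q] by (simp add: conj_def card_k)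

lemma hermitian_form_conj: "hermitian_form q a x y = a * symplectic_form x (map_vec conj y)"
  unfolding hermitian_form_eq conj_def[abs_def] ..

lemma map_vec_conj_block_vec:
  "map_vec conj (block_vec v (A *v v)) =
    block_vec (map_vec conj v) (map_matrix conj A *v map_vec conj v)"
  by (simp add: block_vec_eq_iff flip: map_vec_matrix_vector_mult[OF field_embedding_conj])

text \<open>On the graph of \<open>A\<close> the form is \<open>a\<close> times the bilinear form of
  conj(A) - A^T, evaluated at u and the conjugate of w. Unit vectors are fixed by conjugation, so
  they read off the entries.\<close>

lemma totally_isotropic_graph_space_iff:
  fixes A :: "'f^'n^'n"
  assumes "a \<noteq> 0"
  shows "totally_isotropic (hermitian_form q a) (graph_space A) \<longleftrightarrow> map_matrix conj A = transpose A"
proof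
  assume iso: "totally_isotropic (hermitian_form q a) (graph_space A)"
  have conj_axis: "map_vec conj (axis j 1) = axis j 1" for j :: 'n
    by (simp add: vec_eq_iff axis_def field_embedding_0[OF field_embedding_conj]
        field_embedding_1[OF field_embedding_conj])
  have "conj (A $ i $ j) = A $ j $ i" for i j
  proof -
    have "0 = hermitian_form q a (block_vec (axis i 1) (A *v axis i 1)) (block_vec (axis j 1) (A *v axis j 1))"
      using iso unfolding totally_isotropic_def graph_space_eq by auto
    then show ?thesis
      using assms unfolding hermitian_form_conj map_vec_conj_block_vec symplectic_form_graph conj_axis
        sum_axis_axis by simp
  qed
  then show "map_matrix conj A = transpose A"
    by (simp add: vec_eq_iff transpose_def)
next
  assume "map_matrix conj A = transpose A"
  then have "conj (A $ i $ j) = A $ j $ i" for i j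
    by (simp add: vec_eq_iff transpose_def)
  then show "totally_isotropic (hermitian_form q a) (graph_space A)"
    unfolding totally_isotropic_def graph_space_eq
    by (auto simp: hermitian_form_conj map_vec_conj_block_vec symplectic_form_graph)
qed

lemma totally_isotropic_infinity_space:
  "totally_isotropic (hermitian_form q a) (infinity_space :: ('f^('n::finite + 'n)) set)"
  unfolding totally_isotropic_def infinity_space_eq
  by (auto simp: hermitian_form_conj symplectic_form_eq field_embedding_0[OF field_embedding_conj])

text \<open>The case of standard position. \<open>conj_V\<close> says that entries lie in F_q; with
  symmetry, all members of \<open>V\<close> are hermitian.\<close>

lemma maximal_spread_of_set:
  fixes V :: "('f^'n^'n) set"
  assumes "a \<noteq> 0" and zero: "0 \<in> V"
    and add: "\<And>A B. A \<in> V \<Longrightarrow> B \<in> V \<Longrightarrow> A + B \<in> V"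
    and minus: "\<And>A. A \<in> V \<Longrightarrow> - A \<in> V"
    and card: "card V = q ^ CARD('n)"
    and sym: "\<And>A. A \<in> V \<Longrightarrow> transpose A = A"
    and conj_V: "\<And>A. A \<in> V \<Longrightarrow> map_matrix conj A = A"
    and inv: "\<And>A. A \<in> V \<Longrightarrow> A \<noteq> 0 \<Longrightarrow> det A \<noteq> 0"
  shows "maximal_partial_spread (hermitian_polar_space q a) (spread_of_set V)"
proof -
  let ?H = "hermitian_polar_space q a :: ('f^('n + 'n)) set set"
  have disj: "graph_space A \<inter> graph_space B = {0}" if "A \<in> V" "B \<in> V" "A \<noteq> B" for A B
    unfolding graph_space_Int_graph_space_iff
    using inv[of "A - B"] add[OF that(1) minus[OF that(2)]] that by simp
  have "graph_space A \<in> ?H" if "A \<in> V" for A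
    using that by (simp add: hermitian_polar_space_def subspace_graph_space
        totally_isotropic_graph_space_iff[OF \<open>a \<noteq> 0\<close>] sym conj_V)
  moreover have "infinity_space \<in> ?H"
    by (simp add: hermitian_polar_space_def subspace_infinity_space totally_isotropic_infinity_space)
  ultimately have "spread_of_set V \<subseteq> {S \<in> ?H. vec.dim S = CARD('n)}"
    by (auto simp: spread_of_set_def dim_graph_space dim_infinity_space)
  moreover have "S \<inter> T = {0}" if ST: "S \<in> spread_of_set V" "T \<in> spread_of_set V" "S \<noteq> T" for S T
  proof -
    have swap: "infinity_space \<inter> graph_space A = {0}" for A
      by (subst Int_commute) (rule graph_space_Int_infinity_space)
    consider A where "S = graph_space A" "T = infinity_space"
      | A where "S = infinity_space" "T = graph_space A"
      | A B where "A \<in> V" "S = graph_space A" "B \<in> V" "T = graph_space B"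
      using ST unfolding spread_of_set_def by blast
    then show ?thesis
    proof cases
      case 1
      then show ?thesis by (simp only: graph_space_Int_infinity_space)
    next
      case 2
      then show ?thesis by (simp only: swap)
    next
      case 3
      then show ?thesis using disj ST(3) by metis
    qed
  qed
  ultimately have "partial_spread ?H (spread_of_set V)"
    unfolding partial_spread_def by blast
  moreover have False if E: "partial_spread ?H E" "spread_of_set V \<subset> E" for E
  proof -
    obtain T where T: "T \<in> E" "T \<notin> spread_of_set V" using E by blast
    have "T \<in> ?H" "vec.dim T = CARD('n)"
      using E T by (auto simp: partial_spread_def)
    then have sub: "vec.subspace T" and iso: "totally_isotropic (hermitian_form q a) T"
      by (auto simp: hermitian_polar_space_def)
    have T_disj: "T \<inter> S = {0}" if "S \<in> spread_of_set V" for S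
    proof -
      have "S \<in> E" "S \<noteq> T" using that E(2) T(2) by auto
      then show ?thesis using E(1) T(1) unfolding partial_spread_def by metis
    qed
    then have "T \<inter> infinity_space = {0}" by (simp add: spread_of_set_def)
    then obtain M where M: "graph_space M \<subseteq> T"
      using ex_graph_space_subset[OF sub \<open>vec.dim T = CARD('n)\<close>] by blast
    then have "totally_isotropic (hermitian_form q a) (graph_space M)"
      using iso by (auto simp: totally_isotropic_def)
    then have hermitian: "map_matrix conj M = transpose M"
      using totally_isotropic_graph_space_iff[OF \<open>a \<noteq> 0\<close>] by blast
    \<comment> \<open>Conjugating the determinant of a hermitian matrix gives that of its transpose,
      hence the same value.\<close>
    have det_fixed: "det B ^ q = det B" if "map_matrix conj B = transpose B" for B :: "'f^'n^'n"
      using det_map_matrix[OF field_embedding_conj, of B] that by (simp add: conj_def)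
    obtain e where e: "q = CHAR('f) ^ e" "e > 0" by (rule q_eq_CHAR_power)
    have "\<exists>A\<in>V. det (A + M) = 0"
    proof (rule exists_singular_translate[OF _ zero add prime_CHAR e card inv])
      show "det A ^ q = det A" if "A \<in> V" for A
        using that by (intro det_fixed) (simp add: sym conj_V)
      show "det (A + M) ^ q = det (A + M)" if "A \<in> V" for A
        using conj_V[OF that] sym[OF that] hermitian
        by (intro det_fixed) (simp add: vec_eq_iff transpose_def field_embedding_add[OF field_embedding_conj])
    qed auto
    then obtain A where A: "A \<in> V" "det (A + M) = 0" by blast
    \<comment> \<open>Intersections are governed by differences, so the singular sum
      \<open>A + M\<close> produces a clash with the graph of \<open>- A\<close>, which also belongs
      to the spread.\<close>
    then have "graph_space M \<inter> graph_space (- A) \<noteq> {0}"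
      unfolding graph_space_Int_graph_space_iff by (simp add: add.commute)
    moreover have "T \<inter> graph_space (- A) = {0}"
      using A minus by (intro T_disj) (simp add: spread_of_set_def)
    ultimately show False
      using M vec.subspace_0[OF subspace_graph_space, of M] vec.subspace_0[OF subspace_graph_space, of "- A"] by blast
  qed
  ultimately show ?thesis
    unfolding maximal_partial_spread_def by blast
qed

text \<open>The columns of the extended matrix are images of \<open>G\<close> applied to unit
  vectors, so their pairings agree with those of the identity matrix. Conjugation fixes the extended
  matrix and therefore commutes with its action up to conjugating the vector.\<close>

lemma hermitian_form_isometry:
  fixes G :: "'k^('n::finite + 'n)^('n + 'n)"
  assumes "\<And>x y. symplectic_form (G *v x) (G *v y) = symplectic_form x y"
  shows "hermitian_form q a (map_matrix \<iota> G *v x) (map_matrix \<iota> G *v y) = hermitian_form q a x y"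
proof -
  have column: "column i (map_matrix \<iota> B) = map_vec \<iota> (B *v axis i 1)" for B :: "'k^('n + 'n)^('n + 'n)" and i
    by (simp add: vec_eq_iff column_def matrix_vector_mult_def axis_def if_distrib cong: if_cong)
  have "symplectic_form (map_matrix \<iota> G *v x) (map_matrix \<iota> G *v y) =
      symplectic_form (map_matrix \<iota> (mat 1) *v x) (map_matrix \<iota> (mat 1) *v y)" for x y
    unfolding symplectic_form_matrix[of "map_matrix \<iota> G"] symplectic_form_matrix[of "map_matrix \<iota> (mat 1)"]
      column symplectic_form_map_vec[OF embedding] assms by simp
  then have "symplectic_form (map_matrix \<iota> G *v x) (map_matrix \<iota> G *v y) = symplectic_form x y" for x y
    by (simp add: map_matrix_mat_1[OF embedding])
  moreover have "map_matrix conj (map_matrix \<iota> G) = map_matrix \<iota> G"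
    by (simp add: vec_eq_iff conj_embedding)
  ultimately show ?thesis
    by (simp add: hermitian_form_conj map_vec_matrix_vector_mult[OF field_embedding_conj])
qed

lemma spread_extension_isometry:
  fixes G :: "'k^('n::finite + 'n)^('n + 'n)"
  shows "spread_extension \<iota> ((`) ((*v) G) ` spread_of_set U) =
    (`) ((*v) (map_matrix \<iota> G)) ` spread_of_set (map_matrix \<iota> ` U)"
proof -
  have "extend_scalars \<iota> (graph_space A) = graph_space (map_matrix \<iota> A)" for A :: "'k^'n^'n"
    unfolding graph_space_eq
    by (subst extend_scalars_image[OF embedding linear_graph[of "map_matrix \<iota> A"]])
      (simp_all add: block_vec_eq_iff extend_scalars_UNIV[OF embedding]
        flip: map_vec_matrix_vector_mult[OF embedding])
  moreover have "extend_scalars \<iota> (infinity_space :: ('k^('n + 'n)) set) = infinity_space"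
    unfolding infinity_space_eq
    by (subst extend_scalars_image[OF embedding linear_block_vec_0])
      (simp_all add: block_vec_eq_iff extend_scalars_UNIV[OF embedding] field_embedding_0[OF embedding])
  moreover have "extend_scalars \<iota> ((*v) G ` S) = (*v) (map_matrix \<iota> G) ` extend_scalars \<iota> S" for S
    by (rule extend_scalars_image[OF embedding matrix_vector_mul_linear_gen])
      (rule map_vec_matrix_vector_mult[OF embedding])
  ultimately show ?thesis
    by (simp add: spread_extension_def spread_of_set_def image_image)
qed

end

section \<open>Isometries preserve partial spreads and maximality\<close>

lemma partial_spread_isometry:
  fixes D :: "('f::field^('n::finite + 'n)) set set" and G :: "'f^('n + 'n)^('n + 'n)"
  assumes D: "partial_spread (hermitian_polar_space q a) D" and "inj ((*v) G)"
    and iso: "\<And>x y. hermitian_form q a (G *v x) (G *v y) = hermitian_form q a x y"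
  shows "partial_spread (hermitian_polar_space q a) ((`) ((*v) G) ` D)"
proof -
  have "vec.subspace ((*v) G ` S)" if "vec.subspace S" for S
    using that by (rule vec.linear_subspace_image[OF matrix_vector_mul_linear_gen])
  moreover have "vec.dim ((*v) G ` S) = vec.dim S" for S
    using assms(2) by (intro vec.dim_image_eq matrix_vector_mul_linear_gen) (auto intro: inj_on_subset)
  ultimately have "(`) ((*v) G) ` D \<subseteq> {S \<in> hermitian_polar_space q a. vec.dim S = CARD('n)}"
    using D by (auto simp: partial_spread_def hermitian_polar_space_def totally_isotropic_def iso)
  moreover have "(*v) G ` S \<inter> (*v) G ` T = {0}" if "S \<in> D" "T \<in> D" "(*v) G ` S \<noteq> (*v) G ` T" for S T
  proof -
    have "S \<inter> T = {0}" using D that unfolding partial_spread_def by metis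
    then show ?thesis by (simp flip: image_Int[OF assms(2)])
  qed
  ultimately show ?thesis
    unfolding partial_spread_def by blast
qed

text \<open>A larger partial spread containing the image would be carried by the inverse isometry to
  one strictly containing \<open>D\<close>.\<close>

lemma maximal_partial_spread_isometry:
  fixes D :: "('f::field^('n::finite + 'n)) set set" and G G' :: "'f^('n + 'n)^('n + 'n)"
  assumes D: "maximal_partial_spread (hermitian_polar_space q a) D"
    and inverse: "G ** G' = mat 1" "G' ** G = mat 1"
    and iso: "\<And>x y. hermitian_form q a (G *v x) (G *v y) = hermitian_form q a x y"
  shows "maximal_partial_spread (hermitian_polar_space q a) ((`) ((*v) G) ` D)"
proof -
  have cancel: "G *v (G' *v x) = x" "G' *v (G *v x) = x" for x
    by (simp_all add: matrix_vector_mul_assoc inverse)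
  have inj: "inj ((*v) G)" "inj ((*v) G')"
    by (metis cancel injI)+
  have iso': "hermitian_form q a (G' *v x) (G' *v y) = hermitian_form q a x y" for x y
    using iso[of "G' *v x" "G' *v y"] by (simp add: cancel)
  have "False" if E: "partial_spread (hermitian_polar_space q a) E" "(`) ((*v) G) ` D \<subset> E" for E
  proof -
    have "(`) ((*v) G') ` (`) ((*v) G) ` D \<subset> (`) ((*v) G') ` E"
      using E(2) image_strict_mono[of "(`) ((*v) G')" E] inj(2) by (simp add: inj_image_eq_iff inj_on_def)
    then have "D \<subset> (`) ((*v) G') ` E"
      by (simp add: image_image cancel)
    with partial_spread_isometry[OF E(1) inj(2) iso'] D show False
      unfolding maximal_partial_spread_def by blast
  qed
  moreover have "partial_spread (hermitian_polar_space q a) ((`) ((*v) G) ` D)"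
    using D unfolding maximal_partial_spread_def by (intro partial_spread_isometry inj iso) auto
  ultimately show ?thesis
    unfolding maximal_partial_spread_def by blast
qed

theorem theorem5p3:
  fixes q :: nat
    and \<iota> :: "'k::{field,finite} \<Rightarrow> 'f::{field,finite}"
    and a :: 'f
    and D :: "('k^('n::finite + 'n)) set set"
  assumes "primepow q"
    and "CARD('k) = q"
    and "CARD('f) = q ^ 2"
    and "field_embedding \<iota>"
    and "a \<noteq> 0"
    and "a ^ q = - a"
    and "semifield_spread D"
  shows "maximal_partial_spread (hermitian_polar_space q a) (spread_extension \<iota> D)"
proof -
  interpret quadratic_field_extension q \<iota>
    using assms by unfold_locales
  from assms(7) obtain U :: "('k^'n^'n) set" and g where U: "linear_spread_set U"
    and g: "symplectic_isometry g" and D: "D = (`) g ` spread_of_set U"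
    by (auto simp: semifield_spread_def)
  have U_add: "\<And>A B. A \<in> U \<Longrightarrow> B \<in> U \<Longrightarrow> A + B \<in> U"
    and U_sym: "\<And>A. A \<in> U \<Longrightarrow> transpose A = A"
    and U_inv: "\<And>A. A \<in> U \<Longrightarrow> A \<noteq> 0 \<Longrightarrow> invertible A"
    and U_card: "card U = q ^ CARD('n)"
    using U by (auto simp: linear_spread_set_def card_k)
  obtain K where K: "subfield_of K" and scale: "\<And>c A. c \<in> K \<Longrightarrow> A \<in> U \<Longrightarrow> map_matrix ((*) c) A \<in> U"
    using U by (auto simp: linear_spread_set_def)
  have "q > 0" using primepow_q primepow_gt_Suc_0 by fastforce
  then have "U \<noteq> {}" using U_card by auto
  moreover have "map_matrix ((*) 0) A = 0" "map_matrix ((*) (- 1)) A = - A" for A :: "'k^'n^'n"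
    by (simp_all add: vec_eq_iff)
  \<comment> \<open>The subfield \<open>K\<close> contains 0 and -1, so its scalars produce the zero
    matrix and negatives.\<close>
  ultimately have U_0: "0 \<in> U" and U_minus: "\<And>A. A \<in> U \<Longrightarrow> - A \<in> U"
    using scale K unfolding subfield_of_def by (metis ex_in_conv)+
  have map_0: "map_matrix \<iota> (0 :: 'k^'n^'n) = 0"
    by (simp add: vec_eq_iff field_embedding_0[OF embedding])
  \<comment> \<open>Passing to the matrix of \<open>g\<close> lets the isometry be extended to
    F_(q^2) entrywise.\<close>
  define G where "G = matrix g"
  have G: "(*v) G = g"
    using g matrix_works unfolding symplectic_isometry_def G_def by blast
  then obtain G' where G': "G ** G' = mat 1" "G' ** G = mat 1"
    using g invertible_eq_bij unfolding symplectic_isometry_def invertible_def by metis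
  \<comment> \<open>Maximality is first shown in standard position; the extended isometry then
    carries it to the given spread.\<close>
  have "maximal_partial_spread (hermitian_polar_space q a) (spread_of_set (map_matrix \<iota> ` U))"
  proof (rule maximal_spread_of_set[OF \<open>a \<noteq> 0\<close>])
    show "card (map_matrix \<iota> ` U) = q ^ CARD('n)"
      unfolding U_card[symmetric]
      by (intro card_image inj_onI) (simp add: vec_eq_iff inj_eq[OF field_embedding_inj[OF embedding]])
    show "det A \<noteq> 0" if A: "A \<in> map_matrix \<iota> ` U" "A \<noteq> 0" for A
    proof -
      obtain B where B: "B \<in> U" "A = map_matrix \<iota> B" using A(1) by blast
      then have "B \<noteq> 0" using A(2) map_0 by auto
      then show ?thesis
        using U_inv[OF B(1)] B(2)
        by (simp add: invertible_det_nz det_map_matrix[OF embedding] field_embedding_eq_0_iff[OF embedding])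
    qed
    show "0 \<in> map_matrix \<iota> ` U"
      using U_0 map_0 by (metis imageI)
    show "A + B \<in> map_matrix \<iota> ` U" if AB: "A \<in> map_matrix \<iota> ` U" "B \<in> map_matrix \<iota> ` U" for A B
    proof -
      obtain A' B' where "A' \<in> U" "B' \<in> U" "A = map_matrix \<iota> A'" "B = map_matrix \<iota> B'"
        using AB by blast
      then show ?thesis
        using U_add by (intro image_eqI[of _ _ "A' + B'"]) (auto simp: vec_eq_iff field_embedding_add[OF embedding])
    qed
    show "- A \<in> map_matrix \<iota> ` U" if A: "A \<in> map_matrix \<iota> ` U" for A
    proof -
      obtain A' where "A' \<in> U" "A = map_matrix \<iota> A'"
        using A by blast
      then show ?thesis
        using U_minus by (intro image_eqI[of _ _ "- A'"]) (auto simp: vec_eq_iff field_embedding_minus[OF embedding])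
    qed
    show "transpose A = A" if "A \<in> map_matrix \<iota> ` U" for A
      using that U_sym by (auto simp: vec_eq_iff transpose_def)
    show "map_matrix conj A = A" if "A \<in> map_matrix \<iota> ` U" for A
      using that by (auto simp: vec_eq_iff conj_embedding)
  qed
  then have "maximal_partial_spread (hermitian_polar_space q a)
      ((`) ((*v) (map_matrix \<iota> G)) ` spread_of_set (map_matrix \<iota> ` U))"
  proof (rule maximal_partial_spread_isometry)
    show "map_matrix \<iota> G ** map_matrix \<iota> G' = mat 1" "map_matrix \<iota> G' ** map_matrix \<iota> G = mat 1"
      by (simp_all add: G' map_matrix_mat_1[OF embedding] flip: map_matrix_matrix_mult[OF embedding])
    have "symplectic_form (G *v x) (G *v y) = symplectic_form x y" for x y
      using g by (simp add: symplectic_isometry_def flip: G)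
    then show "hermitian_form q a (map_matrix \<iota> G *v x) (map_matrix \<iota> G *v y) = hermitian_form q a x y" for x y
      by (rule hermitian_form_isometry)
  qed
  then show ?thesis
    unfolding D G[symmetric] spread_extension_isometry .
qed

end
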